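(* If $\kappa>\omega$ is a regular cardinal, then $\pi\chi(x,K)<\kappa$ for every $\kappa$-Corson compact space $K$ and every $x\in K$.
   Context: For an infinite cardinal $\kappa$ and a set $\Gamma$, $\Sigma_\kappa(\mathbb{R}^\Gamma)=\{x\in\mathbb{R}^\Gamma:\ |\{\gamma\in\Gamma:x(\gamma)\neq0\}|<\kappa\}$ with the topology inherited from the product. A compact (Hausdorff) space is $\kappa$-Corson compact if it is homeomorphic to a subset of $\Sigma_\kappa(\mathbb{R}^\Gamma)$ for some set $\Gamma$. $\pi\chi(x,K)$ is the $\pi$-character of $K$ at $x$, i.e. the minimal cardinality of a local $\pi$-base at $x$ (a family of nonempty open subsets of $K$ such that every neighborhood of $x$ contains a member of the family). *)

theory Defs
  imports "HOL-Analysis.Analysis"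
begin

unbundle cardinal_syntax

text \<open>Cardinals are rendered as in the library: as relations \<open>\<kappa>\<close> with \<open>Card_order \<kappa>\<close>, over an
  arbitrary type, compared by \<open><o\<close> and \<open>\<le>o\<close>. The cardinality of a set \<open>A\<close> is \<open>|A|\<close>.\<close>

text \<open>Elements of \<open>\<real>\<^sup>\<Gamma>\<close> are the extensional functions on \<open>\<Gamma>\<close>, i.e. the points of
  \<open>product_topology (\<lambda>_. euclideanreal) \<Gamma>\<close>.\<close>

definition Sigma_prod :: "'k rel \<Rightarrow> 'g set \<Rightarrow> ('g \<Rightarrow> real) set" where
  "Sigma_prod \<kappa> \<Gamma> = {x \<in> \<Gamma> \<rightarrow>\<^sub>E (UNIV :: real set). |{\<gamma> \<in> \<Gamma>. x \<gamma> \<noteq> 0}| <o \<kappa>}"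

definition Sigma_prod_topology :: "'k rel \<Rightarrow> 'g set \<Rightarrow> ('g \<Rightarrow> real) topology" where
  "Sigma_prod_topology \<kappa> \<Gamma> =
     subtopology (product_topology (\<lambda>_. euclideanreal) \<Gamma>) (Sigma_prod \<kappa> \<Gamma>)"

text \<open>A definition cannot quantify over types, so the type \<open>'g\<close> from which the index set \<open>\<Gamma>\<close> is
  drawn is a parameter; a statement assuming this predicate for a free type variable \<open>'g\<close> covers
  index sets of every type.\<close>

definition kappa_Corson_compact :: "'k rel \<Rightarrow> 'g itself \<Rightarrow> 'a topology \<Rightarrow> bool" where
  "kappa_Corson_compact \<kappa> (_ :: 'g itself) K \<longleftrightarrow>
     compact_space K \<and> Hausdorff_space K \<and>
     (\<exists>(\<Gamma> :: 'g set) S. S \<subseteq> Sigma_prod \<kappa> \<Gamma> \<and>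
        K homeomorphic_space subtopology (Sigma_prod_topology \<kappa> \<Gamma>) S)"

definition neighborhood_of :: "'a topology \<Rightarrow> 'a \<Rightarrow> 'a set \<Rightarrow> bool" where
  "neighborhood_of X x N \<longleftrightarrow> N \<subseteq> topspace X \<and> (\<exists>U. openin X U \<and> x \<in> U \<and> U \<subseteq> N)"

definition local_pi_base :: "'a topology \<Rightarrow> 'a \<Rightarrow> 'a set set \<Rightarrow> bool" where
  "local_pi_base X x \<B> \<longleftrightarrow>
     (\<forall>B\<in>\<B>. openin X B \<and> B \<noteq> {}) \<and>
     (\<forall>N. neighborhood_of X x N \<longrightarrow> (\<exists>B\<in>\<B>. B \<subseteq> N))"

text \<open>The \<open>\<pi>\<close>-character is determined only up to \<open>=o\<close>, hence the choice operator.\<close>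

definition pi_character :: "'a topology \<Rightarrow> 'a \<Rightarrow> 'a set rel" where
  "pi_character X x =
     (SOME r. (\<exists>\<B>. local_pi_base X x \<B> \<and> r = |\<B>| ) \<and>
              (\<forall>\<B>. local_pi_base X x \<B> \<longrightarrow> r \<le>o |\<B>| ))"

lemma local_pi_base_exists: "\<exists>\<B>. local_pi_base X x \<B>"
proof
  show "local_pi_base X x {U. openin X U \<and> U \<noteq> {}}"
    unfolding local_pi_base_def neighborhood_of_def by blast
qed

lemma pi_character_minimum:
  "(\<exists>\<B>. local_pi_base X x \<B> \<and> pi_character X x = |\<B>| ) \<and>
   (\<forall>\<B>. local_pi_base X x \<B> \<longrightarrow> pi_character X x \<le>o |\<B>| )"
proof -
  let ?C = "card_of ` {\<B>. local_pi_base X x \<B>}"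
  obtain r0 where "r0 \<in> ?C"
    using local_pi_base_exists[of X x] by blast
  then have "\<exists>r\<in>?C. \<forall>s. s <o r \<longrightarrow> s \<notin> ?C"
    by (rule wf_ordLess[unfolded wf_eq_minimal, rule_format])
  then obtain r where r: "r \<in> ?C" and min: "\<And>s. s <o r \<Longrightarrow> s \<notin> ?C"
    by (elim bexE) simp
  have "r \<le>o |\<B>|" if "local_pi_base X x \<B>" for \<B>
  proof -
    have "Well_order r"
      using r card_of_Well_order by auto
    moreover have "\<not> |\<B>| <o r"
      using min[of "|\<B>|"] that by blast
    ultimately show ?thesis
      by (simp add: not_ordLess_iff_ordLeq card_of_Well_order)
  qed
  with r have "\<exists>r. (\<exists>\<B>. local_pi_base X x \<B> \<and> r = |\<B>| ) \<and>
      (\<forall>\<B>. local_pi_base X x \<B> \<longrightarrow> r \<le>o |\<B>| )"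
    by (intro exI[of _ r]) auto
  then show ?thesis
    unfolding pi_character_def by (rule someI_ex)
qed

end

theory Submission
  imports Defs
begin

text \<open>A \<open>\<kappa>\<close>-Corson compact space is tight in the following sense: every point of the closure
  of \<open>A\<close> lies in the closure of a subset of \<open>A\<close> of size \<open>< \<kappa>\<close>. The \<open>\<pi>\<close>-character is then
  bounded by Shapirovskii's free sequence argument. If no local \<open>\<pi>\<close>-base at \<open>x\<close> has size \<open>< \<kappa>\<close>,
  one chooses by recursion continuous functions \<open>f\<^sub>a\<close>, \<open>a < \<kappa>\<close>, vanishing at \<open>x\<close>, such that every
  nonempty finite intersection of earlier sets \<open>{f\<^sub>b < 1/3}\<close>, \<open>{f\<^sub>b > 2/3}\<close> contains a point where
  \<open>f\<^sub>a = 1\<close>. By compactness there are points \<open>s\<^sub>a\<close> with \<open>f\<^sub>b(s\<^sub>a) \<le> 1/3\<close> for \<open>b \<le> a\<close> and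
  \<open>f\<^sub>b(s\<^sub>a) \<ge> 2/3\<close> for \<open>b > a\<close>. A point in the closure of every tail of \<open>s\<close> lies in the closure
  of some initial segment of \<open>s\<close>, by tightness and regularity; but these closures are disjoint.\<close>

text \<open>Adjoining \<open>topspace X\<close> to the family puts the common point inside the space
  even when \<open>I\<close> is empty.\<close>

lemma compact_space_fip_indexed:
  assumes "compact_space X" "\<And>i. i \<in> I \<Longrightarrow> closedin X (C i)"
    and fip: "\<And>J. finite J \<Longrightarrow> J \<subseteq> I \<Longrightarrow> topspace X \<inter> (\<Inter>i\<in>J. C i) \<noteq> {}"
  obtains y where "y \<in> topspace X" "\<And>i. i \<in> I \<Longrightarrow> y \<in> C i"
proof -
  let ?U = "insert (topspace X) (C ` I)"
  have "\<Inter>\<F> \<noteq> {}" if "finite \<F>" "\<F> \<subseteq> ?U" for \<F>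
  proof -
    have "finite (\<F> - {topspace X})" "\<F> - {topspace X} \<subseteq> C ` I"
      using that by auto
    then obtain J where J: "J \<subseteq> I" "finite J" "\<F> - {topspace X} = C ` J"
      using finite_subset_image by meson
    have "topspace X \<inter> (\<Inter>i\<in>J. C i) \<subseteq> \<Inter>\<F>"
      using J(3) by auto
    then show ?thesis
      using fip[OF J(2,1)] by blast
  qed
  moreover have "\<forall>C\<in>?U. closedin X C"
    using assms(2) by auto
  ultimately have "\<Inter>?U \<noteq> {}"
    using assms(1) unfolding compact_space_fip by meson
  then show thesis
    using that by auto
qed

section \<open>Sets of size below a regular uncountable cardinal\<close>

locale uncountable_regular_card =
  fixes \<kappa> :: "'k rel"
  assumes card: "Card_order \<kappa>" and uncountable: "natLeq <o \<kappa>" and regular: "regularCard \<kappa>"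
begin

lemma infinite_Field: "infinite (Field \<kappa>)"
  using infinite_iff_natLeq_ordLeq ordLeq_ordIso_trans[OF ordLess_imp_ordLeq[OF uncountable]]
    ordIso_symmetric[OF card_of_Field_ordIso[OF card]] by blast

lemma well_order: "Well_order \<kappa>"
  using card card_order_on_well_order_on by blast

lemma order:
  "Refl \<kappa>" "trans \<kappa>" "antisym \<kappa>" "Total \<kappa>"
  using well_order
  by (auto simp: well_order_on_def linear_order_on_def partial_order_on_def preorder_on_def)

lemma not_le_imp_le: "a \<in> Field \<kappa> \<Longrightarrow> b \<in> Field \<kappa> \<Longrightarrow> (b, a) \<notin> \<kappa> \<Longrightarrow> (a, b) \<in> \<kappa>"
  using order(1,4) unfolding total_on_def refl_on_def by metis

lemma small_nat: "|UNIV :: nat set| <o \<kappa>"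
  using card_of_nat ordIso_ordLess_trans uncountable by blast

lemma small_finite: "finite A \<Longrightarrow> |A| <o \<kappa>"
  using finite_ordLess_infinite[OF card_of_Well_order well_order] infinite_Field
  by (simp add: Field_card_of)

lemma small_UN: "|I| <o \<kappa> \<Longrightarrow> (\<And>i. i \<in> I \<Longrightarrow> |A i| <o \<kappa>) \<Longrightarrow> |\<Union>i\<in>I. A i| <o \<kappa>"
  using regularCard_stable[OF card infinite_Field regular] stable_UNION by blast

lemma small_Un: "|A| <o \<kappa> \<Longrightarrow> |B| <o \<kappa> \<Longrightarrow> |A \<union> B| <o \<kappa>"
  using card_of_Un_ordLess_infinite_Field[OF infinite_Field card] by blast

lemma small_image: "|A| <o \<kappa> \<Longrightarrow> |f ` A| <o \<kappa>"
  using card_of_image ordLeq_ordLess_trans by blast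

lemma small_mono: "|B| <o \<kappa> \<Longrightarrow> A \<subseteq> B \<Longrightarrow> |A| <o \<kappa>"
  using card_of_mono1 ordLeq_ordLess_trans by blast

text \<open>Induction on \<open>n\<close> bounds the \<open>n\<close>-element subsets: each
  \<open>(n+1)\<close>-element subset arises by inserting a point of \<open>A\<close>, so regularity
  applies. Uncountability of \<open>\<kappa>\<close> then permits the union over all
  \<open>n\<close>.\<close>

lemma small_Fpow:
  assumes A: "|A| <o \<kappa>"
  shows "|Fpow A| <o \<kappa>"
proof -
  define T where "T n = {F. F \<subseteq> A \<and> finite F \<and> card F = n}" for n
  have "|T n| <o \<kappa>" for n
  proof (induction n)
    case 0
    have "T 0 = {{}}"
      by (auto simp: T_def)
    then show ?case
      by (simp add: small_finite)
  next
    case (Suc n)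
    have "T (Suc n) \<subseteq> (\<Union>a\<in>A. insert a ` T n)"
    proof
      fix F assume F: "F \<in> T (Suc n)"
      then obtain a G where "F = insert a G" "a \<notin> G" "card G = n"
        by (auto simp: T_def card_Suc_eq)
      moreover from this F have "a \<in> A" "G \<in> T n"
        by (auto simp: T_def)
      ultimately show "F \<in> (\<Union>a\<in>A. insert a ` T n)"
        by blast
    qed
    moreover have "|\<Union>a\<in>A. insert a ` T n| <o \<kappa>"
      by (intro small_UN A small_image Suc)
    ultimately show ?case
      using small_mono by blast
  qed
  then have "|\<Union>n. T n| <o \<kappa>"
    by (intro small_UN small_nat)
  moreover have "Fpow A \<subseteq> (\<Union>n. T n)"
    by (auto simp: T_def Fpow_def)
  ultimately show ?thesis
    using small_mono by blast
qed

lemma small_bounded: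
  assumes "I \<subseteq> Field \<kappa>" "|I| <o \<kappa>"
  obtains d where "d \<in> Field \<kappa>" "\<And>i. i \<in> I \<Longrightarrow> (i, d) \<in> \<kappa> - Id"
proof -
  have "\<not> ( |I| =o \<kappa>)"
    using assms(2) not_ordLess_ordIso by blast
  then have "\<not> cofinal I \<kappa>"
    using assms(1) regular unfolding regularCard_def by blast
  then obtain a where a: "a \<in> Field \<kappa>" "\<And>b. b \<in> I \<Longrightarrow> a = b \<or> (a, b) \<notin> \<kappa>"
    unfolding cofinal_def by blast
  \<comment> \<open>\<open>cofinal\<close> is phrased with strict order, so its failure only makes
    \<open>a\<close> a weak bound. An infinite cardinal has no largest element, which gives a strict
    one.\<close>
  obtain d where d: "d \<in> Field \<kappa>" "a \<noteq> d" "(a, d) \<in> \<kappa>"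
    using infinite_Card_order_limit[OF card infinite_Field a(1)] by blast
  have "(i, d) \<in> \<kappa> - Id" if i: "i \<in> I" for i
  proof -
    have "(i, a) \<in> \<kappa>"
      using a(2)[OF i] assms(1) a(1) i order(1,4) unfolding total_on_def refl_on_def by (metis subsetD)
    then show ?thesis
      using d order(2,3) unfolding trans_def antisym_def by blast
  qed
  then show thesis
    using that d(1) by blast
qed

section \<open>Tightness of Sigma products\<close>

text \<open>Closing off the support of \<open>y\<close> in \<open>\<omega>\<close> steps gives an index set \<open>S\<close> of size \<open>< \<kappa>\<close> on which \<open>B\<close>
  approximates \<open>y\<close>, while \<open>y\<close> and all of \<open>B\<close> vanish off \<open>S\<close>.\<close>

lemma Sigma_prod_tight:
  fixes \<Gamma> :: "'g set"
  defines "P \<equiv> product_topology (\<lambda>_. euclideanreal) \<Gamma>"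
  assumes A: "A \<subseteq> Sigma_prod \<kappa> \<Gamma>" and y: "y \<in> Sigma_prod \<kappa> \<Gamma>" "y \<in> P closure_of A"
  obtains B where "B \<subseteq> A" "|B| <o \<kappa>" "y \<in> P closure_of B"
proof -
  define supp :: "('g \<Rightarrow> real) \<Rightarrow> 'g set" where "supp z = {\<gamma> \<in> \<Gamma>. z \<gamma> \<noteq> 0}" for z
  have "\<exists>a\<in>A. \<forall>\<gamma>\<in>F. \<bar>a \<gamma> - y \<gamma>\<bar> < 1 / Suc n" if F: "F \<in> Fpow \<Gamma>" for F n
  proof -
    define U where "U \<gamma> = (if \<gamma> \<in> F then ball (y \<gamma>) (1 / Suc n) else UNIV)" for \<gamma>
    have "finite {\<gamma> \<in> \<Gamma>. U \<gamma> \<noteq> topspace euclideanreal}"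
      by (rule finite_subset[of _ F]) (use F in \<open>auto simp: U_def Fpow_def\<close>)
    then have "openin P (Pi\<^sub>E \<Gamma> U)"
      unfolding P_def by (subst openin_PiE_gen) (auto simp: U_def)
    moreover have "y \<in> Pi\<^sub>E \<Gamma> U"
      using y(1) by (auto simp: U_def Sigma_prod_def PiE_iff)
    ultimately obtain a where "a \<in> A" "a \<in> Pi\<^sub>E \<Gamma> U"
      using y(2) by (auto simp: in_closure_of)
    moreover have "\<bar>a \<gamma> - y \<gamma>\<bar> < 1 / Suc n" if "\<gamma> \<in> F" for \<gamma>
    proof -
      have "\<gamma> \<in> \<Gamma>"
        using F that by (auto simp: Fpow_def)
      then have "a \<gamma> \<in> U \<gamma>"
        using \<open>a \<in> Pi\<^sub>E \<Gamma> U\<close> by (rule PiE_mem[rotated])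
      then show ?thesis
        using that by (simp add: U_def dist_real_def abs_minus_commute)
    qed
    ultimately show ?thesis
      by blast
  qed
  then obtain pick where pick: "\<And>F n. F \<in> Fpow \<Gamma> \<Longrightarrow> pick F n \<in> A"
      "\<And>F n \<gamma>. F \<in> Fpow \<Gamma> \<Longrightarrow> \<gamma> \<in> F \<Longrightarrow> \<bar>pick F n \<gamma> - y \<gamma>\<bar> < 1 / Suc n"
    by metis
  \<comment> \<open>Approximants are collected for finite sets of coordinates only, and for
    countably many accuracies; this keeps \<open>pts S\<close> small whenever \<open>S\<close>
    is.\<close>
  define pts where "pts S = (\<Union>F\<in>Fpow S. range (pick F))" for S
  define S where "S = rec_nat (supp y) (\<lambda>_ S. S \<union> (\<Union>z\<in>pts S. supp z))"
  have S_Suc: "S (Suc n) = S n \<union> (\<Union>z\<in>pts (S n). supp z)" for n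
    by (simp add: S_def)
  have pts_A: "pts S \<subseteq> A" if "S \<subseteq> \<Gamma>" for S
    using pick(1) Fpow_mono[OF that] by (auto simp: pts_def)
  have small_pts: "|pts S| <o \<kappa>" if "|S| <o \<kappa>" for S
    unfolding pts_def by (intro small_UN small_Fpow small_image small_nat that)
  have small_S: "S n \<subseteq> \<Gamma> \<and> |S n| <o \<kappa>" for n
  proof (induction n)
    case 0
    then show ?case
      using y(1) by (auto simp: S_def supp_def Sigma_prod_def)
  next
    case (Suc n)
    have "|supp z| <o \<kappa>" if "z \<in> pts (S n)" for z
      using that pts_A Suc A by (auto simp: supp_def Sigma_prod_def)
    then have "|\<Union>z\<in>pts (S n). supp z| <o \<kappa>"
      using Suc small_UN small_pts by blast
    then show ?case
      using Suc by (auto simp: S_Suc supp_def intro: small_Un)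
  qed
  have S_mono: "S m \<subseteq> S n" if "m \<le> n" for m n
    using that by (rule lift_Suc_mono_le[rotated]) (auto simp: S_Suc)
  define B where "B = (\<Union>n. pts (S n))"
  have "y \<in> P closure_of B"
    unfolding in_closure_of
  proof (intro conjI allI impI)
    show "y \<in> topspace P"
      using y(2) by (simp add: in_closure_of)
    fix T assume T: "y \<in> T \<and> openin P T"
    then obtain U where U: "finite {\<gamma> \<in> \<Gamma>. U \<gamma> \<noteq> UNIV}" "\<And>\<gamma>. \<gamma> \<in> \<Gamma> \<Longrightarrow> open (U \<gamma>)"
        "y \<in> Pi\<^sub>E \<Gamma> U" "Pi\<^sub>E \<Gamma> U \<subseteq> T"
      unfolding P_def openin_product_topology_alt by fastforce
    define F where "F = {\<gamma> \<in> \<Gamma>. U \<gamma> \<noteq> UNIV}"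
    \<comment> \<open>The stages increase and \<open>F\<close> is finite, so a single stage
      \<open>S n\<close> already holds every coordinate of \<open>F\<close> that ever enters. The
      \<open>0\<close> inserted below covers the case that none does.\<close>
    obtain r where r: "\<And>\<gamma>. \<gamma> \<in> F \<inter> (\<Union>m. S m) \<Longrightarrow> \<gamma> \<in> S (r \<gamma>)"
      by (metis IntD2 UN_E)
    define n where "n = Max (insert 0 (r ` (F \<inter> (\<Union>m. S m))))"
    have n: "F \<inter> (\<Union>m. S m) \<subseteq> S n"
    proof
      fix \<gamma> assume \<gamma>: "\<gamma> \<in> F \<inter> (\<Union>m. S m)"
      then have "r \<gamma> \<le> n"
        using U(1) unfolding n_def F_def by (intro Max_ge) auto
      then show "\<gamma> \<in> S n"
        using r[OF \<gamma>] S_mono by blast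
    qed
    define G where "G = F \<inter> S n"
    have G: "finite G" "G \<in> Fpow (S n)" "G \<in> Fpow \<Gamma>"
      using U(1) small_S by (auto simp: G_def F_def Fpow_def)
    have "\<exists>e>0. ball (y \<gamma>) e \<subseteq> U \<gamma>" if "\<gamma> \<in> G" for \<gamma>
      using U(2)[of \<gamma>] U(3) that by (auto simp: G_def F_def open_contains_ball PiE_iff)
    then obtain e where e: "\<And>\<gamma>. \<gamma> \<in> G \<Longrightarrow> e \<gamma> > 0 \<and> ball (y \<gamma>) (e \<gamma>) \<subseteq> U \<gamma>"
      by metis
    define d where "d = Min (insert 1 (e ` G))"
    have d: "d > 0" "\<And>\<gamma>. \<gamma> \<in> G \<Longrightarrow> d \<le> e \<gamma>"
      using G(1) e by (auto simp: d_def)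
    obtain k where k: "1 / Suc k < d"
      using nat_approx_posE[OF d(1)] by blast
    define z where "z = pick G k"
    have zB: "z \<in> pts (S n)"
      using G(2) by (auto simp: z_def pts_def)
    then have "z \<in> A"
      using pts_A small_S by blast
    have "z \<gamma> \<in> U \<gamma>" if \<gamma>: "\<gamma> \<in> \<Gamma>" for \<gamma>
    proof (cases "\<gamma> \<in> F")
      case True
      show ?thesis
      proof (cases "\<gamma> \<in> S n")
        case True
        then have "\<gamma> \<in> G"
          using \<open>\<gamma> \<in> F\<close> by (simp add: G_def)
        then have "dist (y \<gamma>) (z \<gamma>) < e \<gamma>"
          using pick(2)[OF G(3), of \<gamma> k] k d(2)[of \<gamma>]
          by (simp add: z_def dist_real_def abs_minus_commute)
        then show ?thesis
          using e[OF \<open>\<gamma> \<in> G\<close>] by (auto simp: subset_iff)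
      next
        case False
        \<comment> \<open>A coordinate outside all stages needs no approximation: \<open>S 0\<close>
          is the support of \<open>y\<close> and \<open>S (Suc n)\<close> contains that of
          \<open>z\<close>, so both vanish there.\<close>
        then have no: "\<gamma> \<notin> S m" for m
          using n \<open>\<gamma> \<in> F\<close> by blast
        have "y \<gamma> = 0"
          using no[of 0] \<gamma> by (auto simp: S_def supp_def)
        moreover have "z \<gamma> = 0"
          using no[of "Suc n"] \<gamma> zB by (auto simp: S_Suc supp_def)
        ultimately show ?thesis
          using U(3) \<gamma> by (metis PiE_mem)
      qed
    next
      case False
      then show ?thesis
        using \<gamma> by (auto simp: F_def)
    qed
    then have "z \<in> Pi\<^sub>E \<Gamma> U"
      using \<open>z \<in> A\<close> A by (auto simp: Sigma_prod_def PiE_iff)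
    then show "\<exists>b. b \<in> B \<and> b \<in> T"
      using zB U(4) by (auto simp: B_def)
  qed
  moreover have "B \<subseteq> A"
    using pts_A small_S by (auto simp: B_def)
  moreover have "|B| <o \<kappa>"
    unfolding B_def by (intro small_UN small_nat small_pts) (use small_S in auto)
  ultimately show thesis
    using that by blast
qed

section \<open>Free sequences and local pi-bases in tight compact spaces\<close>

lemma finite_max:
  assumes "finite J" "J \<noteq> {}" "J \<subseteq> Field \<kappa>"
  obtains m where "m \<in> J" "\<And>j. j \<in> J \<Longrightarrow> (j, m) \<in> \<kappa>"
proof -
  have "\<exists>m\<in>J. \<forall>j\<in>J. (j, m) \<in> \<kappa>"
    using assms
  proof (induction J rule: finite_ne_induct)
    case (singleton a)
    then show ?case
      using order(1) by (auto simp: refl_on_def)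
  next
    case (insert a J)
    then obtain m where m: "m \<in> J" "\<forall>j\<in>J. (j, m) \<in> \<kappa>"
      by auto
    have a: "a \<in> Field \<kappa>" "m \<in> Field \<kappa>" "a \<noteq> m"
      using insert m by auto
    then consider "(a, m) \<in> \<kappa>" | "(m, a) \<in> \<kappa>"
      using order(4) by (auto simp: total_on_def)
    then show ?case
    proof cases
      case 1
      then show ?thesis
        using m by blast
    next
      case 2
      then have "\<forall>j\<in>insert a J. (j, a) \<in> \<kappa>"
        using m order(1,2) a by (auto simp: refl_on_def elim: transE)
      then show ?thesis
        by blast
    qed
  qed
  then show thesis
    using that by blast
qed

text \<open>Tightness is isolated as a hypothesis, so the free sequence argument takes place in
  \<open>K\<close> itself, without coordinates.\<close>

lemma small_local_pi_base:
  fixes K :: "'a topology"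
  assumes K: "compact_space K" "Hausdorff_space K" and x: "x \<in> topspace K"
    and tight: "\<And>A y. A \<subseteq> topspace K \<Longrightarrow> y \<in> K closure_of A \<Longrightarrow>
      \<exists>B\<subseteq>A. |B| <o \<kappa> \<and> y \<in> K closure_of B"
  obtains \<B> where "local_pi_base K x \<B>" "|\<B>| <o \<kappa>"
proof (rule ccontr)
  assume "\<not> thesis"
  with that have no_base: "\<not> local_pi_base K x \<B>" if "|\<B>| <o \<kappa>" for \<B>
    using \<open>|\<B>| <o \<kappa>\<close> by blast
  define box where
    "box P R = {y \<in> topspace K. (\<forall>h\<in>P. h y < 1/3) \<and> (\<forall>h\<in>R. 2/3 < h y)}"
    for P R :: "('a \<Rightarrow> real) set"
  \<comment> \<open>\<open>Q F g\<close> says that \<open>g\<close> may follow the functions in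
    \<open>F\<close> in the recursion. The strict inequalities in \<open>box\<close> make boxes
    open, hence candidates for a local pi-base.\<close>
  define Q where
    "Q F g \<longleftrightarrow> continuous_map K euclideanreal g \<and> g x = 0 \<and>
      (\<forall>P\<in>Fpow F. \<forall>R\<in>Fpow F. box P R \<noteq> {} \<longrightarrow> (\<exists>y\<in>box P R. g y = 1))" for F g
  have open_box: "openin K (box P R)"
    if "finite P" "finite R" "\<And>h. h \<in> P \<union> R \<Longrightarrow> continuous_map K euclideanreal h" for P R
  proof -
    have eq: "box P R = ((\<Inter>h\<in>P. {y \<in> topspace K. h y \<in> {..<1/3}}) \<inter> topspace K) \<inter>
        ((\<Inter>h\<in>R. {y \<in> topspace K. h y \<in> {2/3<..}}) \<inter> topspace K)"
      by (auto simp: box_def)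
    have "openin K {y \<in> topspace K. h y \<in> {..<1/3}}" if "h \<in> P" for h
      using \<open>\<And>h. h \<in> P \<union> R \<Longrightarrow> _\<close> that
      by (intro openin_continuous_map_preimage[of K euclideanreal]) auto
    moreover have "openin K {y \<in> topspace K. h y \<in> {2/3<..}}" if "h \<in> R" for h
      using \<open>\<And>h. h \<in> P \<union> R \<Longrightarrow> _\<close> that
      by (intro openin_continuous_map_preimage[of K euclideanreal]) auto
    ultimately show ?thesis
      unfolding eq using \<open>finite P\<close> \<open>finite R\<close> by (intro openin_Int openin_INT) blast+
  qed
  \<comment> \<open>The nonempty boxes over \<open>F\<close> are too few to form a local pi-base, so
    some open \<open>U\<close> around \<open>x\<close> contains none of them. A function that is 0
    at \<open>x\<close> and 1 off \<open>U\<close> then takes the value 1 in every such box.\<close>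
  have step: "\<exists>g. Q F g"
    if F: "|F| <o \<kappa>" "\<And>h. h \<in> F \<Longrightarrow> continuous_map K euclideanreal h" for F
  proof -
    define \<B> where "\<B> = (\<Union>P\<in>Fpow F. box P ` Fpow F) - {{}}"
    have "|\<B>| <o \<kappa>"
      by (rule small_mono[of "\<Union>P\<in>Fpow F. box P ` Fpow F"])
        (auto simp: \<B>_def intro!: small_UN small_image small_Fpow F)
    moreover have "\<forall>B\<in>\<B>. openin K B \<and> B \<noteq> {}"
    proof (intro ballI conjI)
      fix B assume "B \<in> \<B>"
      then obtain P R where "P \<in> Fpow F" "R \<in> Fpow F" "B = box P R" "B \<noteq> {}"
        by (auto simp: \<B>_def)
      moreover from this have "openin K (box P R)"
        using F(2) by (intro open_box) (auto simp: Fpow_def)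
      ultimately show "openin K B" "B \<noteq> {}"
        by auto
    qed
    ultimately obtain N where N: "neighborhood_of K x N" "\<And>B. B \<in> \<B> \<Longrightarrow> \<not> B \<subseteq> N"
      using no_base unfolding local_pi_base_def by metis
    then obtain U where U: "openin K U" "x \<in> U" "U \<subseteq> N"
      by (auto simp: neighborhood_of_def)
    have "completely_regular_space K"
      using K by (intro normal_imp_completely_regular_space
          compact_Hausdorff_or_regular_imp_normal_space) auto
    moreover have "closedin K (topspace K - U)" "x \<in> topspace K - (topspace K - U)"
      using U x by auto
    ultimately obtain g :: "'a \<Rightarrow> real" where
      g: "continuous_map K (top_of_set {0..1}) g" "g x = 0" "g ` (topspace K - U) \<subseteq> {1}"
      unfolding completely_regular_space_def by metis
    have "\<exists>y\<in>box P R. g y = 1" if "P \<in> Fpow F" "R \<in> Fpow F" "box P R \<noteq> {}" for P R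
    proof -
      have "box P R \<in> \<B>"
        using that by (auto simp: \<B>_def)
      then obtain y where "y \<in> box P R" "y \<notin> U"
        using N(2) U(3) by blast
      then show ?thesis
        using g(3) by (auto simp: box_def)
    qed
    then show ?thesis
      using g(1,2) unfolding Q_def continuous_map_in_subtopology by blast
  qed
  have wf: "wf (\<kappa> - Id)"
    using well_order by (simp add: well_order_on_def)
  \<comment> \<open>The choice depends on earlier values only through their set, so the cutoff made
    by \<open>wfrec\<close> does not affect it.\<close>
  define f where "f = wfrec (\<kappa> - Id) (\<lambda>f a. SOME g. Q (f ` underS \<kappa> a) g)"
  have f_eq: "f a = (SOME g. Q (f ` underS \<kappa> a) g)" for a
  proof -
    have "cut f (\<kappa> - Id) a ` underS \<kappa> a = f ` underS \<kappa> a"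
      by (intro image_cong) (auto simp: cut_def underS_def)
    then show ?thesis
      unfolding f_def by (subst wfrec[OF wf]) simp
  qed
  have Qf: "a \<in> Field \<kappa> \<Longrightarrow> Q (f ` underS \<kappa> a) (f a)" for a
  proof (induction a rule: wf_induct_rule[OF wf])
    case (1 a)
    have "continuous_map K euclideanreal h" if "h \<in> f ` underS \<kappa> a" for h
      using that 1 by (auto simp: Q_def underS_def Field_def)
    then have "\<exists>g. Q (f ` underS \<kappa> a) g"
      by (intro step small_image card_of_underS[OF card 1(2)])
    then show ?case
      unfolding f_eq[of a] by (rule someI_ex)
  qed
  have f_cont: "continuous_map K euclideanreal (f a)" and f_x: "f a x = 0"
    if "a \<in> Field \<kappa>" for a
    using Qf[OF that] by (auto simp: Q_def)
  \<comment> \<open>With no high indices, \<open>x\<close> is a witness. Otherwise the largest high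
    index \<open>m\<close> lies above all the others, so by \<open>Q\<close> its function takes the
    value 1 somewhere in the box of the rest.\<close>
  have box_nonempty: "box (f ` I) (f ` J) \<noteq> {}"
    if I: "finite I" "I \<subseteq> Field \<kappa>" and J: "finite J" "J \<subseteq> Field \<kappa>"
      and IJ: "\<And>i j. i \<in> I \<Longrightarrow> j \<in> J \<Longrightarrow> (i, j) \<in> \<kappa> - Id" for I J
    using J IJ
  proof (induction "card J" arbitrary: J)
    case 0
    then have "x \<in> box (f ` I) (f ` J)"
      using x f_x I by (auto simp: box_def)
    then show ?case
      by blast
  next
    case (Suc n)
    then have "J \<noteq> {}"
      by auto
    then obtain m where m: "m \<in> J" "\<And>j. j \<in> J \<Longrightarrow> (j, m) \<in> \<kappa>"
      using Suc finite_max by metis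
    let ?J = "J - {m}"
    have "box (f ` I) (f ` ?J) \<noteq> {}"
      using Suc m by (intro Suc.hyps(1)) auto
    moreover have "f ` I \<in> Fpow (f ` underS \<kappa> m)" "f ` ?J \<in> Fpow (f ` underS \<kappa> m)"
      using m I(1) Suc.prems unfolding Fpow_def underS_def by fast+
    moreover have "Q (f ` underS \<kappa> m) (f m)"
      using m Suc.prems by (intro Qf) auto
    ultimately obtain y where "y \<in> box (f ` I) (f ` ?J)" "f m y = 1"
      unfolding Q_def by blast
    then have "y \<in> box (f ` I) (f ` J)"
      by (auto simp: box_def)
    then show ?case
      by blast
  qed
  have closed_low: "closedin K {y \<in> topspace K. f b y \<in> {..1/3}}"
    and closed_high: "closedin K {y \<in> topspace K. f b y \<in> {2/3..}}" if "b \<in> Field \<kappa>" for b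
    by (rule closedin_continuous_map_preimage[OF f_cont[OF that]], simp)+
  have "\<exists>s. s \<in> topspace K \<and>
      (\<forall>b\<in>Field \<kappa>. if (b, a) \<in> \<kappa> then f b s \<le> 1/3 else 2/3 \<le> f b s)"
    if a: "a \<in> Field \<kappa>" for a
  proof -
    \<comment> \<open>Weakening the strict bounds gives closed sets. A finite set of indices splits
      at \<open>a\<close> into low ones and later high ones, as \<open>box_nonempty\<close>
      requires.\<close>
    let ?C = "\<lambda>b. {y \<in> topspace K. f b y \<in> (if (b, a) \<in> \<kappa> then {..1/3} else {2/3..})}"
    obtain s where s: "s \<in> topspace K" "\<And>b. b \<in> Field \<kappa> \<Longrightarrow> s \<in> ?C b"
    proof (rule compact_space_fip_indexed[OF K(1), of "Field \<kappa>" ?C])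
      show "closedin K (?C b)" if "b \<in> Field \<kappa>" for b
        using closed_low closed_high that by simp
      fix J assume J: "finite J" "J \<subseteq> Field \<kappa>"
      let ?I = "{b \<in> J. (b, a) \<in> \<kappa>}" and ?J = "{b \<in> J. (b, a) \<notin> \<kappa>}"
      have "(i, j) \<in> \<kappa> - Id" if "i \<in> ?I" "j \<in> ?J" for i j
      proof -
        have "(a, j) \<in> \<kappa>"
          using that J a by (auto intro: not_le_imp_le)
        then show ?thesis
          using that transD[OF order(2), of i a j] by auto
      qed
      then have "box (f ` ?I) (f ` ?J) \<noteq> {}"
        using J by (intro box_nonempty) auto
      then obtain y where "y \<in> box (f ` ?I) (f ` ?J)"
        by blast
      then have "y \<in> topspace K \<inter> (\<Inter>b\<in>J. ?C b)"
        by (auto simp: box_def less_imp_le)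
      then show "topspace K \<inter> (\<Inter>b\<in>J. ?C b) \<noteq> {}"
        by blast
    qed (rule that, assumption, blast)
    have "if (b, a) \<in> \<kappa> then f b s \<le> 1/3 else 2/3 \<le> f b s" if "b \<in> Field \<kappa>" for b
      using s(2)[OF that] by (simp split: if_splits)
    then show ?thesis
      using s(1) by blast
  qed
  then obtain s where s: "\<And>a. a \<in> Field \<kappa> \<Longrightarrow> s a \<in> topspace K"
      "\<And>a b. a \<in> Field \<kappa> \<Longrightarrow> (b, a) \<in> \<kappa> \<Longrightarrow> f b (s a) \<le> 1/3"
      "\<And>a b. a \<in> Field \<kappa> \<Longrightarrow> b \<in> Field \<kappa> \<Longrightarrow> (b, a) \<notin> \<kappa> \<Longrightarrow> 2/3 \<le> f b (s a)"
    by (metis FieldI1)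
  let ?tail = "\<lambda>b. {a. (b, a) \<in> \<kappa>}"
  have tail: "?tail b \<subseteq> Field \<kappa>" for b
    by (auto simp: Field_def)
  \<comment> \<open>Finitely many tails share the point \<open>s m\<close> for their largest
    starting index \<open>m\<close>, so compactness gives a point in the closure of every
    tail.\<close>
  obtain y where y: "\<And>b. b \<in> Field \<kappa> \<Longrightarrow> y \<in> K closure_of (s ` ?tail b)"
  proof (rule compact_space_fip_indexed[OF K(1), of "Field \<kappa>" "\<lambda>b. K closure_of (s ` ?tail b)"])
    fix J assume J: "finite J" "J \<subseteq> Field \<kappa>"
    show "topspace K \<inter> (\<Inter>b\<in>J. K closure_of (s ` ?tail b)) \<noteq> {}"
    proof (cases "J = {}")
      case True
      then show ?thesis
        using x by auto
    next
      case False
      then obtain m where m: "m \<in> J" "\<And>j. j \<in> J \<Longrightarrow> (j, m) \<in> \<kappa>"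
        using J finite_max by metis
      have "s m \<in> K closure_of (s ` ?tail b)" if "b \<in> J" for b
      proof -
        have "s ` ?tail b \<subseteq> topspace K"
          using s(1) tail by blast
        then show ?thesis
          using m(2)[OF that] closure_of_subset by blast
      qed
      then show ?thesis
        using s(1) m(1) J(2) by blast
    qed
  qed auto
  obtain b where "b \<in> Field \<kappa>"
    using infinite_Field by fastforce
  then have "y \<in> K closure_of (s ` Field \<kappa>)"
    by (rule subsetD[OF closure_of_mono[OF image_mono[OF tail]] y])
  moreover have "s ` Field \<kappa> \<subseteq> topspace K"
    using s(1) by blast
  ultimately obtain B where B: "B \<subseteq> s ` Field \<kappa>" "|B| <o \<kappa>" "y \<in> K closure_of B"
    using tight by meson
  \<comment> \<open>Injectivity on \<open>I\<close> carries the size bound from points back to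
    indices; regularity then bounds \<open>I\<close> strictly by some \<open>d\<close>.\<close>
  obtain I where I: "I \<subseteq> Field \<kappa>" "inj_on s I" "B = s ` I"
    using B(1) unfolding subset_image_inj by blast
  have "|I| <o \<kappa>"
    using small_image[OF B(2), of "inv_into I s"] I by simp
  then obtain d where d: "d \<in> Field \<kappa>" "\<And>i. i \<in> I \<Longrightarrow> (i, d) \<in> \<kappa> - Id"
    using I(1) small_bounded by metis
  \<comment> \<open>The function \<open>f d\<close> separates \<open>B\<close> from the tail
    starting at \<open>d\<close>, while \<open>y\<close> lies in both closures.\<close>
  have "2/3 \<le> f d (s i)" if "i \<in> I" for i
    using that d I(1) order(3) by (intro s(3)) (auto simp: antisym_def)
  then have "B \<subseteq> {z \<in> topspace K. f d z \<in> {2/3..}}"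
    using I s(1) by auto
  then have "2/3 \<le> f d y"
    using subsetD[OF closure_of_minimal[OF _ closed_high[OF d(1)]] B(3)] by simp
  moreover have "s ` ?tail d \<subseteq> {z \<in> topspace K. f d z \<in> {..1/3}}"
    using s(1) s(2)[OF FieldI2] by (auto dest: FieldI2)
  then have "f d y \<le> 1/3"
    using subsetD[OF closure_of_minimal[OF _ closed_low[OF d(1)]] y[OF d(1)]] by simp
  ultimately show False
    by linarith
qed

end

text \<open>A homeomorphism onto a subset of the Sigma product transfers tightness to
  \<open>K\<close>; the small local pi-base this yields bounds the minimum
  \<open>pi_character K x\<close>.\<close>

theorem lemma7p4:
  fixes \<kappa> :: "'k rel" and K :: "'a topology" and x :: 'a
  assumes "Card_order \<kappa>" and "natLeq <o \<kappa>" and "regularCard \<kappa>"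
    and "kappa_Corson_compact \<kappa> TYPE('g) K"
    and "x \<in> topspace K"
  shows "pi_character K x <o \<kappa>"
proof -
  interpret uncountable_regular_card \<kappa>
    using assms(1-3) by unfold_locales
  obtain \<Gamma> :: "'g set" and S h where
    K: "compact_space K" "Hausdorff_space K" and S: "S \<subseteq> Sigma_prod \<kappa> \<Gamma>" and
    h: "homeomorphic_map K (subtopology (Sigma_prod_topology \<kappa> \<Gamma>) S) h"
    using assms(4) unfolding kappa_Corson_compact_def homeomorphic_space by blast
  let ?P = "product_topology (\<lambda>_. euclideanreal) \<Gamma>"
  have sub: "subtopology (Sigma_prod_topology \<kappa> \<Gamma>) S = subtopology ?P S"
    using S by (simp add: Sigma_prod_topology_def subtopology_subtopology inf_absorb2)
  have "topspace (subtopology ?P S) = S"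
    using S by (auto simp: Sigma_prod_def)
  then have hS: "h ` topspace K = S" and inj: "inj_on h (topspace K)"
    using h homeomorphic_imp_surjective_map homeomorphic_imp_injective_map sub by metis+
  \<comment> \<open>Closures in \<open>K\<close> become traces on \<open>S\<close> of closures in
    the full product, the form in which \<open>Sigma_prod_tight\<close> is stated.\<close>
  have closure_h: "h ` (K closure_of A) = S \<inter> ?P closure_of (h ` A)" if "A \<subseteq> topspace K" for A
  proof -
    have "S \<inter> h ` A = h ` A"
      using that hS by blast
    then show ?thesis
      using homeomorphic_map_closure_of[OF h that] by (simp add: sub closure_of_subtopology)
  qed
  have "\<exists>B\<subseteq>A. |B| <o \<kappa> \<and> y \<in> K closure_of B"
    if A: "A \<subseteq> topspace K" and y: "y \<in> K closure_of A" for A y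
  proof -
    have "h y \<in> S \<inter> ?P closure_of (h ` A)"
      using closure_h[OF A] y by blast
    moreover have "h ` A \<subseteq> Sigma_prod \<kappa> \<Gamma>"
      using A hS S by blast
    ultimately obtain C where C: "C \<subseteq> h ` A" "|C| <o \<kappa>" "h y \<in> ?P closure_of C"
      using Sigma_prod_tight[of "h ` A" \<Gamma> "h y"] S by blast
    obtain B where B: "B \<subseteq> A" "inj_on h B" "C = h ` B"
      using C(1) unfolding subset_image_inj by blast
    have BK: "B \<subseteq> topspace K"
      using A B by blast
    have "h y \<in> h ` (K closure_of B)"
      using closure_h[OF BK] C B \<open>h y \<in> S \<inter> _\<close> by blast
    moreover have "y \<in> topspace K" "K closure_of B \<subseteq> topspace K"
      using y closure_of_subset_topspace by fast+
    ultimately have "y \<in> K closure_of B"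
      using inj by (simp add: inj_on_image_mem_iff)
    moreover have "|B| <o \<kappa>"
      using small_image[OF C(2), of "inv_into B h"] B by simp
    ultimately show ?thesis
      using B(1) by blast
  qed
  then obtain \<B> where "local_pi_base K x \<B>" "|\<B>| <o \<kappa>"
    using small_local_pi_base[OF K assms(5)] by blast
  then show ?thesis
    using pi_character_minimum[of K x] ordLeq_ordLess_trans by blast
qed

end
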